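(* In the setting and notation of the context, the semi-discrete finite volume scheme for the reduced model $$\frac{\partial\mathbf u^\ell}{\partial t}+\sum_{r\in\mathcal N^\ell}\frac{|\partial\omega^{\ell r}|}{|\omega^\ell|}\left(\hat{\mathcal F}^{\ell r}+\mathcal D^{\ell r}+\mathcal G^{\ell r}\right)\cdot\mathbf n^{\ell r}=\mathbf S(\mathbf u^\ell),$$ with the geometrically and thermodynamically compatible fluxes $\hat{\mathcal F}$, the non-conservative products $\mathcal D$ and the dissipation terms $\mathcal G$ defined in the context, where $\mathbf u=(\rho\mathbf v,\mathcal E,\mathbf A,\mathbf J)$ is understood as augmented by the density component $\rho=\rho_0|\mathbf A|$, satisfies the extra conservation law for the entropy (the entropy balance) with the following conservative semi-discrete scheme: $$\frac{\partial\mathcal S^\ell}{\partial t}+\sum_{r\in\mathcal N^\ell}\frac{|\partial\omega^{\ell r}|}{|\omega^\ell|}\,\frac12\left(F_{\mathcal S}^\ell+F_{\mathcal S}^r\right)\cdot\mathbf n^{\ell r}=\Pi^\ell+\frac{\alpha_{ik}^\ell\alpha_{ik}^\ell}{\theta_1(\tau_1)T^\ell}+\frac{\beta_k^\ell\beta_k^\ell}{\theta_2(\tau_2)T^\ell},$$ where $$F_{\mathcal S}^\ell\cdot\mathbf n^{\ell r}=\left((\mathcal Sv_k+\beta_k)^\ell-\mathbf r^\ell\cdot\mathbf f_k^\ell\right)n_k^{\ell r}+\mathbf r^\ell\cdot\left(\hat{\mathcal F}^{\ell r}+\mathcal D^{\ell r}\right)\cdot\mathbf n^{\ell r}+2\epsilon^{\ell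 r}\mathcal S^\ell,$$ $$F_{\mathcal S}^r\cdot\mathbf n^{\ell r}=\left((\mathcal Sv_k+\beta_k)^r-\mathbf r^r\cdot\mathbf f_k^r\right)n_k^{\ell r}+\mathbf r^r\cdot\left(\hat{\mathcal F}^{\ell r}+\mathcal D^{r\ell}\right)\cdot\mathbf n^{\ell r}-2\epsilon^{\ell r}\mathcal S^r,$$ $$\Pi^\ell=-\sum_{r\in\mathcal N^\ell}\frac{|\partial\omega^{\ell r}|}{|\omega^\ell|}\,\frac12\epsilon^{\ell r}(\mathbf u^r-\mathbf u^\ell)\cdot\partial^2_{\mathbf{uu}}\mathcal S^{\ell r}(\mathbf u^r-\mathbf u^\ell).$$ Furthermore, assuming $T^\ell>0$ and $\partial^2_{\mathbf{uu}}\mathcal S^{\ell r}\le0$, the right hand side of the entropy balance is non-negative, $$\Pi^\ell+\frac{\alpha_{ik}^\ell\alpha_{ik}^\ell}{\theta_1(\tau_1)T^\ell}+\frac{\beta_k^\ell\beta_k^\ell}{\theta_2(\tau_2)T^\ell}\ge0,$$ therefore the scheme also satisfies a cell entropy inequality.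
   Context: Conventions: repeated lower tensor indices in $\{1,2,3\}$ are summed; superscripts $\ell,r$ label cells; "$\cdot$" between state-type vectors or matrices is the full contraction (Euclidean inner product); $|\mathbf A|=\det\mathbf A$. Mesh: a two-dimensional domain is divided into non-overlapping polygonal cells $\omega^\ell$ of area $|\omega^\ell|$; $\mathcal N^\ell$ is the set of neighbors of $\omega^\ell$; $\partial\omega^{\ell r}$ is the shared edge, of length $|\partial\omega^{\ell r}|$, with unit normal $\mathbf n^{\ell r}=(n_1,n_2,0)$ pointing out of $\omega^\ell$. Thus $\mathbf n^{r\ell}=-\mathbf n^{\ell r}$ and $\sum_{r\in\mathcal N^\ell}|\partial\omega^{\ell r}|\,\mathbf n^{\ell r}=\mathbf 0$. State and energy: $\mathbf u=(\rho,\rho v_i,\mathcal E,A_{ik},J_k)$ (augmented state: density, momentum, total energy, distortion tensor, thermal impulse), with $\rho=\rho_0|\mathbf A|>0$, $|\mathbf A|>0$, where $\rho_0>0$ is the initial density ($\rho_0^\ell$ in cell $\ell$). The entropy density $\mathcal S=\rho S$ ($S$ the specific entropy) is related to the total energy by $$\mathcal E=\frac{\rho^\gamma}{\gamma-1}e^{S/c_v}+\frac12\rho v_iv_i+\frac14\rho c_s^2\mathring G_{ij}\mathring G_{ij}+\frac12c_h^2\rho J_iJ_i,$$ with $G_{mk}=A_{jm}A_{jk}$, $\mathring G_{mk}=G_{mk}-\frac13G_{jj}\delta_{mk}$ and constants $\gamma$ (polytropic index), $c_v$ (specific heat at constant volume), $c_s$ (shear sound speed), $c_h$ (heat wave speed).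 Regarding $\mathcal E$ as a function of $(\rho,\rho\mathbf v,\mathcal S,\mathbf A,\mathbf J)$, set $r=\partial_\rho\mathcal E$, $v_i=\partial_{\rho v_i}\mathcal E$, $T=\partial_{\mathcal S}\mathcal E$ (temperature), $\alpha_{ik}=\partial_{A_{ik}}\mathcal E=\rho c_s^2A_{im}\mathring G_{mk}$, $\beta_k=\partial_{J_k}\mathcal E=\rho c_h^2J_k$. The pressure is $p=\rho^\gamma e^{S/c_v}$. Regarding $\mathcal S$ as a function of the augmented state $\mathbf u$, the dual variables are $\mathbf r=\partial_{\mathbf u}\mathcal S=\frac1T(-r,-v_i,1,-\alpha_{ik},-\beta_k)$. The reduced vector $\tilde{\mathbf r}=\frac1T(0,-v_i,0,0,-\beta_k)$ keeps only the momentum and thermal impulse entries. (The cell label $r$ and the scalar $r=\partial_\rho\mathcal E$ are unrelated.) Entropy balance at the continuous level: $\partial_t\mathcal S+\partial_{x_k}(\mathcal Sv_k+\beta_k)-\partial_{x_m}(\epsilon\,\partial_{x_m}\mathcal S)=\Pi+\frac{\alpha_{ik}\alpha_{ik}}{\theta_1(\tau_1)T}+\frac{\beta_i\beta_i}{\theta_2(\tau_2)T}\ge0$, with $\epsilon>0$ the vanishing viscosity parameter and $\Pi\ge0$ the entropy production due to the viscous terms. Physical fluxes in direction $x_k$, $\mathbf f_k$: density, $\rho v_k$; momentum, $\rho v_iv_k+p\delta_{ik}+\sigma_{ik}+\phi_{ik}$ with $\sigma_{ik}=A_{ji}\alpha_{jk}$, $\phi_{ik}=J_i\beta_k$; energy,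 $\mathcal Ev_k+pv_k+v_i(\sigma_{ik}+\phi_{ik})+T\beta_k$; distortion $A_{ij}$, $A_{im}v_m\delta_{jk}$; thermal impulse $J_j$, $(J_mv_m+T)\delta_{jk}$. Non-conservative products: $\mathcal D^{\ell r}\cdot\mathbf n^{\ell r}$ vanishes in the density, momentum and energy entries; in the $A_{ik}$ entry it is $\frac12\bar v_m(n_m^{\ell r}(A_{ik}^r-A_{ik}^\ell)-n_k^{\ell r}(A_{im}^r-A_{im}^\ell))$ and in the $J_k$ entry it is $\frac12\bar v_m(n_m^{\ell r}(J_k^r-J_k^\ell)-n_k^{\ell r}(J_m^r-J_m^\ell))$, with $\bar{\mathbf v}$ the velocity of the averaged state $\frac12(\mathbf u^\ell+\mathbf u^r)$. $\mathcal D^{r\ell}\cdot\mathbf n^{r\ell}$ is obtained by exchanging $\ell,r$, and $\mathcal D^{r\ell}\cdot\mathbf n^{\ell r}=-\mathcal D^{r\ell}\cdot\mathbf n^{r\ell}$. $\mathcal D_{\mathbf A}$ denotes the $\mathbf A$ entries of $\mathcal D$. Dissipation: $\mathcal G^{\ell r}\cdot\mathbf n^{\ell r}=-\epsilon^{\ell r}(\mathbf u^r-\mathbf u^\ell)$, $\epsilon^{\ell r}=\frac12\max(|\lambda(\mathbf u^\ell)|,|\lambda(\mathbf u^r)|)$, $\lambda=\sqrt{\gamma p/\rho+\frac43c_s^2+c_h^2}$. Sources: $\mathbf S(\mathbf u^\ell)$ vanishes in the density, momentum and energy entries, equals $-\boldsymbol\alpha^\ell/\theta_1(\tau_1)+\Pi_{\mathbf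 A}^\ell\,\mathbf w^\ell/\mathrm{tr}(\mathbf w^\ell(\mathbf w^\ell)^\top)$ in the $\mathbf A$ entries and $-\beta_k^\ell/\theta_2(\tau_2)$ in the $J_k$ entries, where $\theta_1=\frac13\rho_0\tau_1c_s^2|\mathbf A|^{-5/3}>0$ and $\theta_2=\frac{\rho_0T_0}{T}\tau_2c_h^2>0$, with relaxation times $\tau_1,\tau_2>0$ and $T_0$ a reference temperature; $\mathbf w=\partial_{\mathbf A}|\mathbf A|=|\mathbf A|\mathbf A^{-\top}$; and $$\Pi_{\mathbf A}^\ell=\sum_{r\in\mathcal N^\ell}\frac{|\partial\omega^{\ell r}|}{|\omega^\ell|}\frac12\epsilon^{\ell r}(\mathbf A^r-\mathbf A^\ell)\cdot\partial^2_{\mathbf{AA}}|\mathbf A|^{\ell r}(\mathbf A^r-\mathbf A^\ell),\qquad \partial^2_{\mathbf{AA}}|\mathbf A|^{\ell r}=\int_0^1\partial^2_{\mathbf{AA}}|\mathbf A|(\mathbf A^\ell+s(\mathbf A^r-\mathbf A^\ell))\,ds.$$ Geometrically compatible fluxes $\tilde{\mathcal F}^{\ell r}\cdot\mathbf n^{\ell r}$: for momentum, energy and thermal impulse, the central flux $\frac12(\mathbf f_k^\ell+\mathbf f_k^r)n_k^{\ell r}$. For $\mathbf A$, $\tilde{\mathcal F}_{\mathbf A}^{\ell r}\cdot\mathbf n^{\ell r}=\frac12(\mathbf f_{\mathbf A,k}^\ell+\mathbf f_{\mathbf A,k}^r)n_k^{\ell r}-\alpha_{\mathbf A}^{\ell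 r}(\mathbf w^r-\mathbf w^\ell)$, where $\mathbf f_{\mathbf A,k}$ are the $\mathbf A$ entries of $\mathbf f_k$ and the scalar $\alpha_{\mathbf A}^{\ell r}$ is determined by $$\mathbf w^\ell\cdot(\tilde{\mathcal F}_{\mathbf A}^{\ell r}\cdot\mathbf n^{\ell r}-\mathbf f_{\mathbf A,k}^\ell n_k^{\ell r})+\mathbf w^r\cdot(\mathbf f_{\mathbf A,k}^rn_k^{\ell r}-\tilde{\mathcal F}_{\mathbf A}^{\ell r}\cdot\mathbf n^{\ell r})+\mathbf w^\ell\cdot\mathcal D_{\mathbf A}^{\ell r}\cdot\mathbf n^{\ell r}+\mathbf w^r\cdot\mathcal D_{\mathbf A}^{r\ell}\cdot\mathbf n^{r\ell}=(|\mathbf A|^rv_k^r-|\mathbf A|^\ell v_k^\ell)n_k^{\ell r}$$ ($\alpha_{\mathbf A}^{\ell r}=0$ if $\mathbf w^\ell=\mathbf w^r$). For the density, the flux is $\frac12\rho_0^\ell(F^\ell_{|\mathbf A|}+F^r_{|\mathbf A|})\cdot\mathbf n^{\ell r}$ with $$F^\ell_{|\mathbf A|}\cdot\mathbf n^{\ell r}=(|\mathbf A|^\ell v_k^\ell-\mathbf w^\ell\cdot\mathbf f_{\mathbf A,k}^\ell)n_k^{\ell r}+\mathbf w^\ell\cdot(\tilde{\mathcal F}_{\mathbf A}^{\ell r}+\mathcal D_{\mathbf A}^{\ell r})\cdot\mathbf n^{\ell r}+2\epsilon^{\ell r}|\mathbf A|^\ell,$$ $$F^r_{|\mathbf A|}\cdot\mathbf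 n^{\ell r}=(|\mathbf A|^rv_k^r-\mathbf w^r\cdot\mathbf f_{\mathbf A,k}^r)n_k^{\ell r}+\mathbf w^r\cdot(\tilde{\mathcal F}_{\mathbf A}^{\ell r}+\mathcal D_{\mathbf A}^{r\ell})\cdot\mathbf n^{\ell r}-2\epsilon^{\ell r}|\mathbf A|^r.$$ Thermodynamically compatible fluxes: $\hat{\mathcal F}^{\ell r}\cdot\mathbf n^{\ell r}=\tilde{\mathcal F}^{\ell r}\cdot\mathbf n^{\ell r}-\alpha_S^{\ell r}(\tilde{\mathbf r}^r-\tilde{\mathbf r}^\ell)$, where the scalar $\alpha_S^{\ell r}$ is determined by the requirement $$\mathbf r^\ell\cdot(\hat{\mathcal F}^{\ell r}\cdot\mathbf n^{\ell r}-\mathbf f_k^\ell n_k^{\ell r})+\mathbf r^r\cdot(\mathbf f_k^rn_k^{\ell r}-\hat{\mathcal F}^{\ell r}\cdot\mathbf n^{\ell r})+\mathbf r^\ell\cdot\mathcal D^{\ell r}\cdot\mathbf n^{\ell r}+\mathbf r^r\cdot\mathcal D^{r\ell}\cdot\mathbf n^{r\ell}=\left((\mathcal Sv_k+\beta_k)^r-(\mathcal Sv_k+\beta_k)^\ell\right)n_k^{\ell r},$$ that is, for $\tilde{\mathbf r}^\ell\ne\tilde{\mathbf r}^r$, $$\alpha_S^{\ell r}=\frac{\left((\mathcal Sv_k+\beta_k)^r-(\mathcal Sv_k+\beta_k)^\ell\right)n_k^{\ell r}+(\tilde{\mathcal F}^{\ell r}\cdot\mathbf n^{\ell r})\cdot(\mathbf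 r^r-\mathbf r^\ell)-(\mathbf r^r\cdot\mathbf f_k^r-\mathbf r^\ell\cdot\mathbf f_k^\ell)n_k^{\ell r}-(\mathbf r^r+\mathbf r^\ell)\cdot\mathcal D^{\ell r}\cdot\mathbf n^{\ell r}}{(\tilde{\mathbf r}^r-\tilde{\mathbf r}^\ell)\cdot(\tilde{\mathbf r}^r-\tilde{\mathbf r}^\ell)},$$ and $\alpha_S^{\ell r}=0$ if $\tilde{\mathbf r}^\ell=\tilde{\mathbf r}^r$. Roe-type Hessian: $\partial^2_{\mathbf{uu}}\mathcal S^{\ell r}$ is the interface Hessian matrix of $\mathcal S$, verifying the Roe property $\partial^2_{\mathbf{uu}}\mathcal S^{\ell r}(\mathbf u^r-\mathbf u^\ell)=\mathbf r^r-\mathbf r^\ell$; the condition $\partial^2_{\mathbf{uu}}\mathcal S^{\ell r}\le0$ means that it is negative semi-definite.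
   Formalization: The balance gains a remainder from ½(r^l+r^r)·(u^r−u^l)−(S^r−S^l); the printed balance and cell inequality are stated where this vanishes. The α_S requirement is assumed where reduced duals coincide; conservativity is stated for equal ρ_0. *)

theory Defs
  imports "HOL-Analysis.Analysis"
begin

section \<open>Mesh\<close>

text \<open>
  The scheme sees the polygonal tessellation only through the neighbour sets, the areas, the edge
  lengths and the unit edge normals (planar, embedded in three dimensions).  The last assumption
  says that the boundary of every cell is closed.
\<close>

locale fv_mesh =
  fixes nbrs :: "'c \<Rightarrow> 'c set"
    and area :: "'c \<Rightarrow> real"
    and len :: "'c \<Rightarrow> 'c \<Rightarrow> real"
    and nrm :: "'c \<Rightarrow> 'c \<Rightarrow> real^3"
  assumes finite_nbrs: "finite (nbrs l)"
    and nbrs_irrefl: "l \<notin> nbrs l"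
    and nbrs_sym: "r \<in> nbrs l \<Longrightarrow> l \<in> nbrs r"
    and area_pos: "area l > 0"
    and len_pos: "r \<in> nbrs l \<Longrightarrow> len l r > 0"
    and len_sym: "r \<in> nbrs l \<Longrightarrow> len r l = len l r"
    and nrm_unit: "r \<in> nbrs l \<Longrightarrow> norm (nrm l r) = 1"
    and nrm_planar: "r \<in> nbrs l \<Longrightarrow> nrm l r $ 3 = 0"
    and nrm_antisym: "r \<in> nbrs l \<Longrightarrow> nrm r l = - nrm l r"
    and closed_cell: "(\<Sum>r\<in>nbrs l. len l r *\<^sub>R nrm l r) = 0"

section \<open>State and energy\<close>

record gpr =
  gam :: real
  cv :: real
  cs :: real
  ch :: real
  tau1 :: real
  tau2 :: real
  T0 :: real

text \<open>
  The augmented state (density, momentum, total energy, distortion, thermal impulse).  The inner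
  product of this Euclidean space is the full contraction; \<open>M $ i $ k\<close> is the entry \<open>ik\<close> of the
  matrix \<open>M\<close>.
\<close>

type_synonym state = "real \<times> (real^3) \<times> real \<times> (real^3^3) \<times> (real^3)"

definition density :: "state \<Rightarrow> real" where "density u = fst u"
definition momentum :: "state \<Rightarrow> real^3" where "momentum u = fst (snd u)"
definition energy :: "state \<Rightarrow> real" where "energy u = fst (snd (snd u))"
definition distortion :: "state \<Rightarrow> real^3^3" where "distortion u = fst (snd (snd (snd u)))"
definition impulse :: "state \<Rightarrow> real^3" where "impulse u = snd (snd (snd (snd u)))"

definition velocity :: "state \<Rightarrow> real^3" where
  "velocity u = momentum u /\<^sub>R density u"

definition metric :: "real^3^3 \<Rightarrow> real^3^3" where
  "metric A = transpose A ** A"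

definition dev_metric :: "real^3^3 \<Rightarrow> real^3^3" where
  "dev_metric A = metric A - (trace (metric A) / 3) *\<^sub>R mat 1"

text \<open>The total energy as a function of density, momentum, entropy density, distortion, impulse.\<close>

definition total_energy ::
  "gpr \<Rightarrow> real \<Rightarrow> real^3 \<Rightarrow> real \<Rightarrow> real^3^3 \<Rightarrow> real^3 \<Rightarrow> real" where
  "total_energy c \<rho> m s A J =
     \<rho> powr gam c / (gam c - 1) * exp ((s / \<rho>) / cv c)
     + 1/2 * \<rho> * ((m /\<^sub>R \<rho>) \<bullet> (m /\<^sub>R \<rho>))
     + 1/4 * \<rho> * (cs c)\<^sup>2 * (dev_metric A \<bullet> dev_metric A)
     + 1/2 * (ch c)\<^sup>2 * \<rho> * (J \<bullet> J)"

text \<open>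
  The entropy density is the solution of the energy relation; for an admissible state it exists, and
  it is unique as soon as \<open>cv c \<noteq> 0\<close> and \<open>gam c \<noteq> 1\<close>.
\<close>

definition entropy :: "gpr \<Rightarrow> state \<Rightarrow> real" where
  "entropy c u =
     (THE s. energy u = total_energy c (density u) (momentum u) s (distortion u) (impulse u))"

definition admissible :: "gpr \<Rightarrow> real \<Rightarrow> state \<Rightarrow> bool" where
  "admissible c \<rho>0 u \<longleftrightarrow>
     \<rho>0 > 0 \<and> det (distortion u) > 0 \<and> density u = \<rho>0 * det (distortion u) \<and>
     (\<exists>s. energy u = total_energy c (density u) (momentum u) s (distortion u) (impulse u))"

definition E_density :: "gpr \<Rightarrow> state \<Rightarrow> real" where
  "E_density c u =
     deriv (\<lambda>\<rho>. total_energy c \<rho> (momentum u) (entropy c u) (distortion u) (impulse u)) (density u)"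

definition temperature :: "gpr \<Rightarrow> state \<Rightarrow> real" where
  "temperature c u =
     deriv (\<lambda>s. total_energy c (density u) (momentum u) s (distortion u) (impulse u)) (entropy c u)"

definition alpha :: "gpr \<Rightarrow> state \<Rightarrow> real^3^3" where
  "alpha c u = (density u * (cs c)\<^sup>2) *\<^sub>R (distortion u ** dev_metric (distortion u))"

definition beta :: "gpr \<Rightarrow> state \<Rightarrow> real^3" where
  "beta c u = (density u * (ch c)\<^sup>2) *\<^sub>R impulse u"

definition pressure :: "gpr \<Rightarrow> state \<Rightarrow> real" where
  "pressure c u = density u powr gam c * exp ((entropy c u / density u) / cv c)"

definition dual :: "gpr \<Rightarrow> state \<Rightarrow> state" where
  "dual c u = (1 / temperature c u) *\<^sub>R
     (- E_density c u, - velocity u, 1, - alpha c u, - beta c u)"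

definition dual_red :: "gpr \<Rightarrow> state \<Rightarrow> state" where
  "dual_red c u = (1 / temperature c u) *\<^sub>R (0, - velocity u, 0, 0, - beta c u)"

section \<open>Physical fluxes, non-conservative products, dissipation\<close>

text \<open>
  A function with a last argument \<open>n\<close> is a flux contracted with the direction \<open>n\<close>, and arguments
  \<open>uL\<close>, \<open>uR\<close> are the states in the cell \<open>l\<close> and in its neighbour \<open>r\<close>, respectively.
\<close>

definition sigma :: "gpr \<Rightarrow> state \<Rightarrow> real^3^3" where
  "sigma c u = transpose (distortion u) ** alpha c u"

definition phi :: "gpr \<Rightarrow> state \<Rightarrow> real^3^3" where
  "phi c u = (\<chi> i k. impulse u $ i * beta c u $ k)"

definition flux_A :: "state \<Rightarrow> real^3 \<Rightarrow> real^3^3" where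
  "flux_A u n = (\<chi> i j. (distortion u *v velocity u) $ i * n $ j)"

definition flux :: "gpr \<Rightarrow> state \<Rightarrow> real^3 \<Rightarrow> state" where
  "flux c u n =
     (density u * (velocity u \<bullet> n),
      (velocity u \<bullet> n) *\<^sub>R momentum u + pressure c u *\<^sub>R n + (sigma c u + phi c u) *v n,
      energy u * (velocity u \<bullet> n) + pressure c u * (velocity u \<bullet> n)
        + velocity u \<bullet> ((sigma c u + phi c u) *v n) + temperature c u * (beta c u \<bullet> n),
      flux_A u n,
      (impulse u \<bullet> velocity u + temperature c u) *\<^sub>R n)"

definition entropy_flux :: "gpr \<Rightarrow> state \<Rightarrow> real^3 \<Rightarrow> real" where
  "entropy_flux c u n = (entropy c u *\<^sub>R velocity u + beta c u) \<bullet> n"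

definition avg_velocity :: "state \<Rightarrow> state \<Rightarrow> real^3" where
  "avg_velocity uL uR = velocity ((1/2) *\<^sub>R (uL + uR))"

definition ncp_A :: "state \<Rightarrow> state \<Rightarrow> real^3 \<Rightarrow> real^3^3" where
  "ncp_A uL uR n = (\<chi> i k. 1/2 * (\<Sum>m\<in>UNIV. avg_velocity uL uR $ m *
     (n $ m * (distortion uR $ i $ k - distortion uL $ i $ k)
      - n $ k * (distortion uR $ i $ m - distortion uL $ i $ m))))"

definition ncp_J :: "state \<Rightarrow> state \<Rightarrow> real^3 \<Rightarrow> real^3" where
  "ncp_J uL uR n = (\<chi> k. 1/2 * (\<Sum>m\<in>UNIV. avg_velocity uL uR $ m *
     (n $ m * (impulse uR $ k - impulse uL $ k)
      - n $ k * (impulse uR $ m - impulse uL $ m))))"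

text \<open>
  With \<open>n\<close> the normal from \<open>l\<close> to \<open>r\<close>, the product of \<open>l\<close> with \<open>r\<close> is \<open>ncp uL uR n\<close>; the one of \<open>r\<close>
  with \<open>l\<close> is \<open>ncp uR uL (- n)\<close> when contracted with its own normal \<open>- n\<close>, hence
  \<open>- ncp uR uL (- n)\<close> when contracted with \<open>n\<close>.
\<close>

definition ncp :: "state \<Rightarrow> state \<Rightarrow> real^3 \<Rightarrow> state" where
  "ncp uL uR n = (0, 0, 0, ncp_A uL uR n, ncp_J uL uR n)"

definition wave_speed :: "gpr \<Rightarrow> state \<Rightarrow> real" where
  "wave_speed c u = sqrt (gam c * pressure c u / density u + 4/3 * (cs c)\<^sup>2 + (ch c)\<^sup>2)"

definition eps :: "gpr \<Rightarrow> state \<Rightarrow> state \<Rightarrow> real" where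
  "eps c uL uR = 1/2 * max \<bar>wave_speed c uL\<bar> \<bar>wave_speed c uR\<bar>"

definition dissipation :: "gpr \<Rightarrow> state \<Rightarrow> state \<Rightarrow> state" where
  "dissipation c uL uR = - (eps c uL uR *\<^sub>R (uR - uL))"

section \<open>Determinant and sources\<close>

text \<open>
  \<open>cof u\<close> is the gradient of the determinant at the (invertible) distortion.  The Hessian is defined
  through partial derivatives because the segment between two distortions may meet singular
  matrices.
\<close>

definition cof :: "state \<Rightarrow> real^3^3" where
  "cof u = det (distortion u) *\<^sub>R transpose (matrix_inv (distortion u))"

definition det_grad :: "real^3^3 \<Rightarrow> real^3^3" where
  "det_grad A = (\<chi> i k. frechet_derivative det (at A) (axis i (axis k 1)))"

definition det_hessian :: "real^3^3 \<Rightarrow> real^3^3 \<Rightarrow> real^3^3" where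
  "det_hessian A = frechet_derivative det_grad (at A)"

definition det_hessian_avg :: "real^3^3 \<Rightarrow> real^3^3 \<Rightarrow> real^3^3 \<Rightarrow> real^3^3" where
  "det_hessian_avg A B X = integral {0..1} (\<lambda>s. det_hessian (A + s *\<^sub>R (B - A)) X)"

definition Pi_A ::
  "gpr \<Rightarrow> ('c \<Rightarrow> 'c set) \<Rightarrow> ('c \<Rightarrow> real) \<Rightarrow> ('c \<Rightarrow> 'c \<Rightarrow> real) \<Rightarrow> ('c \<Rightarrow> state) \<Rightarrow> 'c \<Rightarrow> real" where
  "Pi_A c nbrs area len U l =
     (\<Sum>r\<in>nbrs l. len l r / area l * (1/2 * eps c (U l) (U r) *
        ((distortion (U r) - distortion (U l)) \<bullet>
          det_hessian_avg (distortion (U l)) (distortion (U r))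
            (distortion (U r) - distortion (U l)))))"

definition theta1 :: "gpr \<Rightarrow> real \<Rightarrow> state \<Rightarrow> real" where
  "theta1 c \<rho>0 u = 1/3 * \<rho>0 * tau1 c * (cs c)\<^sup>2 * det (distortion u) powr (- 5/3)"

definition theta2 :: "gpr \<Rightarrow> real \<Rightarrow> state \<Rightarrow> real" where
  "theta2 c \<rho>0 u = \<rho>0 * T0 c / temperature c u * tau2 c * (ch c)\<^sup>2"

text \<open>The argument \<open>\<pi>\<close> is the value of \<open>Pi_A\<close> in the cell.\<close>

definition source :: "gpr \<Rightarrow> real \<Rightarrow> real \<Rightarrow> state \<Rightarrow> state" where
  "source c \<rho>0 \<pi> u =
     (0, 0, 0,
      - (alpha c u /\<^sub>R theta1 c \<rho>0 u) + (\<pi> / trace (cof u ** transpose (cof u))) *\<^sub>R cof u,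
      - (beta c u /\<^sub>R theta2 c \<rho>0 u))"

section \<open>Compatible fluxes\<close>

definition geo_flux_A_with :: "real \<Rightarrow> state \<Rightarrow> state \<Rightarrow> real^3 \<Rightarrow> real^3^3" where
  "geo_flux_A_with a uL uR n =
     (1/2) *\<^sub>R (flux_A uL n + flux_A uR n) - a *\<^sub>R (cof uR - cof uL)"

definition alpha_A :: "state \<Rightarrow> state \<Rightarrow> real^3 \<Rightarrow> real" where
  "alpha_A uL uR n =
     (if cof uL = cof uR then 0
      else THE a.
        cof uL \<bullet> (geo_flux_A_with a uL uR n - flux_A uL n)
        + cof uR \<bullet> (flux_A uR n - geo_flux_A_with a uL uR n)
        + cof uL \<bullet> ncp_A uL uR n + cof uR \<bullet> ncp_A uR uL (- n)
        = (det (distortion uR) *\<^sub>R velocity uR - det (distortion uL) *\<^sub>R velocity uL) \<bullet> n)"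

definition geo_flux_A :: "state \<Rightarrow> state \<Rightarrow> real^3 \<Rightarrow> real^3^3" where
  "geo_flux_A uL uR n = geo_flux_A_with (alpha_A uL uR n) uL uR n"

definition det_flux_L :: "gpr \<Rightarrow> state \<Rightarrow> state \<Rightarrow> real^3 \<Rightarrow> real" where
  "det_flux_L c uL uR n =
     det (distortion uL) * (velocity uL \<bullet> n) - cof uL \<bullet> flux_A uL n
     + cof uL \<bullet> (geo_flux_A uL uR n + ncp_A uL uR n)
     + 2 * eps c uL uR * det (distortion uL)"

definition det_flux_R :: "gpr \<Rightarrow> state \<Rightarrow> state \<Rightarrow> real^3 \<Rightarrow> real" where
  "det_flux_R c uL uR n =
     det (distortion uR) * (velocity uR \<bullet> n) - cof uR \<bullet> flux_A uR n
     + cof uR \<bullet> (geo_flux_A uL uR n - ncp_A uR uL (- n))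
     - 2 * eps c uL uR * det (distortion uR)"

text \<open>In the compatible fluxes \<open>\<rho>0\<close> is the initial density of the cell \<open>l\<close>.\<close>

definition geo_flux :: "gpr \<Rightarrow> real \<Rightarrow> state \<Rightarrow> state \<Rightarrow> real^3 \<Rightarrow> state" where
  "geo_flux c \<rho>0 uL uR n =
     (let F = (1/2) *\<^sub>R (flux c uL n + flux c uR n) in
      (1/2 * \<rho>0 * (det_flux_L c uL uR n + det_flux_R c uL uR n),
       momentum F, energy F, geo_flux_A uL uR n, impulse F))"

definition alpha_S :: "gpr \<Rightarrow> real \<Rightarrow> state \<Rightarrow> state \<Rightarrow> real^3 \<Rightarrow> real" where
  "alpha_S c \<rho>0 uL uR n =
     (if dual_red c uL = dual_red c uR then 0
      else (entropy_flux c uR n - entropy_flux c uL n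
            + geo_flux c \<rho>0 uL uR n \<bullet> (dual c uR - dual c uL)
            - (dual c uR \<bullet> flux c uR n - dual c uL \<bullet> flux c uL n)
            - (dual c uR + dual c uL) \<bullet> ncp uL uR n)
           / ((dual_red c uR - dual_red c uL) \<bullet> (dual_red c uR - dual_red c uL)))"

definition thermo_flux :: "gpr \<Rightarrow> real \<Rightarrow> state \<Rightarrow> state \<Rightarrow> real^3 \<Rightarrow> state" where
  "thermo_flux c \<rho>0 uL uR n =
     geo_flux c \<rho>0 uL uR n - alpha_S c \<rho>0 uL uR n *\<^sub>R (dual_red c uR - dual_red c uL)"

text \<open>
  The requirement that determines \<open>alpha_S\<close>.  The formula for \<open>alpha_S\<close> enforces it when the reduced
  dual vectors differ.  When they coincide, no value of \<open>alpha_S\<close> has any influence on it, and it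
  can fail (for instance for two states at rest without thermal impulse and with different
  densities).
\<close>

definition thermo_compatible :: "gpr \<Rightarrow> real \<Rightarrow> state \<Rightarrow> state \<Rightarrow> real^3 \<Rightarrow> bool" where
  "thermo_compatible c \<rho>0 uL uR n \<longleftrightarrow>
     dual c uL \<bullet> (thermo_flux c \<rho>0 uL uR n - flux c uL n)
     + dual c uR \<bullet> (flux c uR n - thermo_flux c \<rho>0 uL uR n)
     + dual c uL \<bullet> ncp uL uR n + dual c uR \<bullet> ncp uR uL (- n)
     = entropy_flux c uR n - entropy_flux c uL n"

section \<open>Scheme and entropy balance\<close>

text \<open>All rows of the augmented system, the density row included.\<close>

definition scheme_at ::
  "gpr \<Rightarrow> ('c \<Rightarrow> 'c set) \<Rightarrow> ('c \<Rightarrow> real) \<Rightarrow> ('c \<Rightarrow> 'c \<Rightarrow> real) \<Rightarrow> ('c \<Rightarrow> 'c \<Rightarrow> real^3) \<Rightarrow>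
   ('c \<Rightarrow> real) \<Rightarrow> ('c \<Rightarrow> real \<Rightarrow> state) \<Rightarrow> 'c \<Rightarrow> real \<Rightarrow> bool" where
  "scheme_at c nbrs area len nrm rho0 u l t \<longleftrightarrow>
     (\<exists>u'. (u l has_vector_derivative u') (at t) \<and>
        u' + (\<Sum>r\<in>nbrs l. (len l r / area l) *\<^sub>R
               (thermo_flux c (rho0 l) (u l t) (u r t) (nrm l r)
                + ncp (u l t) (u r t) (nrm l r)
                + dissipation c (u l t) (u r t)))
        = source c (rho0 l) (Pi_A c nbrs area len (\<lambda>k. u k t) l) (u l t))"

definition entropy_flux_L :: "gpr \<Rightarrow> real \<Rightarrow> state \<Rightarrow> state \<Rightarrow> real^3 \<Rightarrow> real" where
  "entropy_flux_L c \<rho>0 uL uR n =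
     entropy_flux c uL n - dual c uL \<bullet> flux c uL n
     + dual c uL \<bullet> (thermo_flux c \<rho>0 uL uR n + ncp uL uR n)
     + 2 * eps c uL uR * entropy c uL"

definition entropy_flux_R :: "gpr \<Rightarrow> real \<Rightarrow> state \<Rightarrow> state \<Rightarrow> real^3 \<Rightarrow> real" where
  "entropy_flux_R c \<rho>0 uL uR n =
     entropy_flux c uR n - dual c uR \<bullet> flux c uR n
     + dual c uR \<bullet> (thermo_flux c \<rho>0 uL uR n - ncp uR uL (- n))
     - 2 * eps c uL uR * entropy c uR"

definition num_entropy_flux :: "gpr \<Rightarrow> real \<Rightarrow> state \<Rightarrow> state \<Rightarrow> real^3 \<Rightarrow> real" where
  "num_entropy_flux c \<rho>0 uL uR n =
     1/2 * (entropy_flux_L c \<rho>0 uL uR n + entropy_flux_R c \<rho>0 uL uR n)"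

definition roe_hessian :: "gpr \<Rightarrow> state \<Rightarrow> state \<Rightarrow> (state \<Rightarrow> state) \<Rightarrow> bool" where
  "roe_hessian c uL uR H \<longleftrightarrow>
     linear H \<and> (\<forall>x y. x \<bullet> H y = H x \<bullet> y) \<and> H (uR - uL) = dual c uR - dual c uL"

definition neg_semidef :: "(state \<Rightarrow> state) \<Rightarrow> bool" where
  "neg_semidef H \<longleftrightarrow> (\<forall>x. x \<bullet> H x \<le> 0)"

definition Pi_visc ::
  "gpr \<Rightarrow> ('c \<Rightarrow> 'c set) \<Rightarrow> ('c \<Rightarrow> real) \<Rightarrow> ('c \<Rightarrow> 'c \<Rightarrow> real) \<Rightarrow>
   ('c \<Rightarrow> 'c \<Rightarrow> state \<Rightarrow> state) \<Rightarrow> ('c \<Rightarrow> state) \<Rightarrow> 'c \<Rightarrow> real" where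
  "Pi_visc c nbrs area len H U l =
     - (\<Sum>r\<in>nbrs l. len l r / area l *
          (1/2 * eps c (U l) (U r) * ((U r - U l) \<bullet> H l r (U r - U l))))"

definition entropy_production ::
  "gpr \<Rightarrow> ('c \<Rightarrow> 'c set) \<Rightarrow> ('c \<Rightarrow> real) \<Rightarrow> ('c \<Rightarrow> 'c \<Rightarrow> real) \<Rightarrow> ('c \<Rightarrow> real) \<Rightarrow>
   ('c \<Rightarrow> 'c \<Rightarrow> state \<Rightarrow> state) \<Rightarrow> ('c \<Rightarrow> state) \<Rightarrow> 'c \<Rightarrow> real" where
  "entropy_production c nbrs area len rho0 H U l =
     Pi_visc c nbrs area len H U l
     + alpha c (U l) \<bullet> alpha c (U l) / (theta1 c (rho0 l) (U l) * temperature c (U l))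
     + beta c (U l) \<bullet> beta c (U l) / (theta2 c (rho0 l) (U l) * temperature c (U l))"

text \<open>
  The error of the trapezoidal rule for the jump of the entropy density.  The numerical entropy flux
  contains the dissipative part \<open>- eps * (entropy jump)\<close>, whereas by the Roe property the dissipation
  of the scheme contributes \<open>- eps * (trapezoidal sum)\<close> and the production \<open>Pi_visc\<close>.  The balance in
  its conservative form identifies the two; they differ in general.
\<close>

definition jump_error :: "gpr \<Rightarrow> state \<Rightarrow> state \<Rightarrow> real" where
  "jump_error c uL uR =
     1/2 * ((dual c uL + dual c uR) \<bullet> (uR - uL)) - (entropy c uR - entropy c uL)"

end

theory Submission
  imports Defs
begin

text \<open>
  The energy relation can be solved for the entropy in closed form, so the entropy is differentiable
  along the scheme; differentiating the relation itself identifies its rate with the contraction of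
  the dual vector and the scheme.  In this contraction the determinant correction of the source drops
  out, as \<open>\<alpha> \<cdot> A\<^sup>-\<^sup>T\<close> is a multiple of the trace of the trace-free metric.  Compatibility of the fluxes
  says that \<open>F\<^sub>S\<^sup>l - F\<^sub>S\<^sup>r = 2 \<epsilon> (S\<^sup>l + S\<^sup>r)\<close>, whence the numerical entropy flux is
  \<open>F\<^sub>S\<^sup>l - \<epsilon> (S\<^sup>l + S\<^sup>r)\<close>; its part that depends on cell \<open>l\<close> alone is linear in the normal and
  cancels over the closed cell boundary.  The Roe property splits the contraction with the dissipation
  into the entropy jump, the production and the trapezoidal error.
\<close>

section \<open>Contractions of matrices and the trace-free metric\<close>

lemma inner_transpose_transpose:
  "transpose X \<bullet> transpose Y = X \<bullet> (Y :: real^'n^'m)"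
  by (simp add: inner_vec_def transpose_def) (rule sum.swap)

text \<open>Both sides are the triple sum of \<open>X $ i $ k * Y $ k $ j * Z $ i $ j\<close>,
  summed in different orders. This is the rule that carries the distortion from one factor of a
  contraction to the other.\<close>

lemma inner_matrix_mult_left:
  "(X ** Y) \<bullet> Z = Y \<bullet> (transpose X ** (Z :: real^'n^'m))"
proof -
  have "(X ** Y) \<bullet> Z = (\<Sum>i\<in>UNIV. \<Sum>j\<in>UNIV. \<Sum>k\<in>UNIV. X $ i $ k * Y $ k $ j * Z $ i $ j)"
    by (simp add: inner_vec_def matrix_matrix_mult_def sum_distrib_right)
  also have "\<dots> = (\<Sum>i\<in>UNIV. \<Sum>k\<in>UNIV. \<Sum>j\<in>UNIV. X $ i $ k * Y $ k $ j * Z $ i $ j)"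
    by (intro sum.cong refl sum.swap)
  also have "\<dots> = (\<Sum>k\<in>UNIV. \<Sum>i\<in>UNIV. \<Sum>j\<in>UNIV. X $ i $ k * Y $ k $ j * Z $ i $ j)"
    by (rule sum.swap)
  also have "\<dots> = (\<Sum>k\<in>UNIV. \<Sum>j\<in>UNIV. \<Sum>i\<in>UNIV. X $ i $ k * Y $ k $ j * Z $ i $ j)"
    by (intro sum.cong refl sum.swap)
  also have "\<dots> = Y \<bullet> (transpose X ** Z)"
    by (simp add: inner_vec_def matrix_matrix_mult_def transpose_def sum_distrib_left mult_ac)
  finally show ?thesis .
qed

lemma inner_mat_1: "X \<bullet> mat 1 = trace (X :: real^'n^'n)"
  by (simp add: inner_vec_def mat_def trace_def if_distrib cong: if_cong)

lemma transpose_minus_matrix: "transpose (X - Y) = transpose X - transpose (Y :: real^'n^'m)"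
  by (simp add: transpose_def vec_eq_iff)

lemma transpose_dev_metric: "transpose (dev_metric A) = dev_metric A"
  by (simp add: dev_metric_def metric_def transpose_minus_matrix transpose_scalar matrix_transpose_mul)

lemma trace_dev_metric: "trace (dev_metric A) = 0"
  by (simp add: dev_metric_def trace_def mat_def sum_subtractf)

section \<open>Differentiation of the energy along a curve\<close>

lemma bounded_linear_trace: "bounded_linear (trace :: real^'n^'n \<Rightarrow> real)"
  unfolding linear_conv_bounded_linear[symmetric]
  by (rule linearI) (simp_all add: trace_def sum.distrib sum_distrib_left)

text \<open>Treating the transpose as part of the product lets the product rule apply to the metric
  in one step.\<close>

lemma bounded_bilinear_transpose_mult:
  "bounded_bilinear (\<lambda>(X :: real^'n^'m) (Y :: real^'k^'m). transpose X ** Y)"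
  unfolding bilinear_conv_bounded_bilinear[symmetric] bilinear_def
  by (auto intro!: linearI simp: transpose_def matrix_matrix_mult_def vec_eq_iff sum.distrib
      sum_distrib_left algebra_simps)

text \<open>The factor 4 is a 2 from the square times a 2 from the two terms of the product rule for
  the metric, which contribute equally because the deviator is symmetric. The trace part of the
  derivative is lost since the deviator is trace-free. With the weight 1/4 in the energy this yields
  \<alpha>.\<close>

lemma has_real_derivative_dev_metric_norm:
  assumes "(A has_vector_derivative A') (at t)"
  shows "((\<lambda>s. dev_metric (A s) \<bullet> dev_metric (A s)) has_real_derivative
           4 * ((A t ** dev_metric (A t)) \<bullet> A')) (at t)"
proof -
  define M' where "M' = transpose (A t) ** A' + transpose A' ** A t"
  have M: "((\<lambda>s. metric (A s)) has_vector_derivative M') (at t)"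
    unfolding metric_def M'_def
    by (rule bounded_bilinear.has_vector_derivative[OF bounded_bilinear_transpose_mult assms assms])
  have "((\<lambda>s. trace (metric (A s))) has_vector_derivative trace M') (at t)"
    by (rule bounded_linear.has_vector_derivative[OF bounded_linear_trace M])
  then have D: "((\<lambda>s. dev_metric (A s)) has_vector_derivative M' - (trace M' / 3) *\<^sub>R mat 1) (at t)"
    unfolding dev_metric_def using M
    by (auto intro!: derivative_eq_intros simp: has_real_derivative_iff_has_vector_derivative)
  have "((\<lambda>s. dev_metric (A s) \<bullet> dev_metric (A s)) has_vector_derivative
          2 * (dev_metric (A t) \<bullet> (M' - (trace M' / 3) *\<^sub>R mat 1))) (at t)"
    using bounded_bilinear.has_vector_derivative[OF bounded_bilinear_inner D D]
    by (simp add: inner_commute)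
  moreover have "dev_metric (A t) \<bullet> (transpose A' ** A t) = dev_metric (A t) \<bullet> (transpose (A t) ** A')"
    by (subst inner_transpose_transpose[symmetric]) (simp add: transpose_dev_metric matrix_transpose_mul)
  then have "dev_metric (A t) \<bullet> (M' - (trace M' / 3) *\<^sub>R mat 1)
      = 2 * (dev_metric (A t) \<bullet> (transpose (A t) ** A'))"
    by (simp add: M'_def inner_diff_right inner_mat_1 trace_dev_metric inner_add_right)
  moreover have "dev_metric (A t) \<bullet> (transpose (A t) ** A') = (A t ** dev_metric (A t)) \<bullet> A'"
    by (simp add: inner_matrix_mult_left)
  ultimately show ?thesis
    by (simp add: has_real_derivative_iff_has_vector_derivative)
qed

lemma has_real_derivative_inner_self:
  fixes f :: "real \<Rightarrow> 'a :: real_inner"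
  assumes "(f has_vector_derivative f') (at t)"
  shows "((\<lambda>s. f s \<bullet> f s) has_real_derivative 2 * (f t \<bullet> f')) (at t)"
  using bounded_bilinear.has_vector_derivative[OF bounded_bilinear_inner assms assms]
  by (simp add: inner_commute has_real_derivative_iff_has_vector_derivative)

text \<open>The chain rule along a curve gives all partial derivatives of the energy at once.\<close>

lemma has_real_derivative_total_energy:
  assumes "(\<rho> has_real_derivative \<rho>') (at t)" "(m has_vector_derivative m') (at t)"
    "(S has_real_derivative S') (at t)" "(A has_vector_derivative A') (at t)"
    "(J has_vector_derivative J') (at t)" and pos: "\<rho> t > 0" and g: "gam c \<noteq> 1" "cv c \<noteq> 0"
  shows "((\<lambda>s. total_energy c (\<rho> s) (m s) (S s) (A s) (J s)) has_real_derivative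
    (let e = \<rho> t powr gam c / (gam c - 1) * exp (S t / \<rho> t / cv c) in
     (gam c * e / \<rho> t - e * S t / (\<rho> t)\<^sup>2 / cv c - 1/2 * ((m t /\<^sub>R \<rho> t) \<bullet> (m t /\<^sub>R \<rho> t))
       + 1/4 * (cs c)\<^sup>2 * (dev_metric (A t) \<bullet> dev_metric (A t)) + 1/2 * (ch c)\<^sup>2 * (J t \<bullet> J t)) * \<rho>'
     + (m t /\<^sub>R \<rho> t) \<bullet> m'
     + e / (\<rho> t * cv c) * S'
     + (\<rho> t * (cs c)\<^sup>2) *\<^sub>R (A t ** dev_metric (A t)) \<bullet> A'
     + (\<rho> t * (ch c)\<^sup>2) *\<^sub>R J t \<bullet> J')) (at t)"
proof -
  have "((\<lambda>s. m s \<bullet> m s / \<rho> s) has_real_derivative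
      2 * (m t \<bullet> m') / \<rho> t - (m t \<bullet> m t) * \<rho>' / (\<rho> t)\<^sup>2) (at t)"
    using has_real_derivative_inner_self[OF assms(2)] assms(1) pos
    by (auto intro!: derivative_eq_intros simp: field_simps power2_eq_square)
  \<comment> \<open>The equality holds for every \<open>s\<close>: where \<open>\<rho> s\<close>
    vanishes, both sides are 0 by the convention for division.\<close>
  moreover have "\<forall>\<^sub>F s in nhds t. \<rho> s * ((m s /\<^sub>R \<rho> s) \<bullet> (m s /\<^sub>R \<rho> s)) = m s \<bullet> m s / \<rho> s"
    by (simp add: divide_simps)
  ultimately have kin: "((\<lambda>s. \<rho> s * ((m s /\<^sub>R \<rho> s) \<bullet> (m s /\<^sub>R \<rho> s))) has_real_derivative
      2 * (m t \<bullet> m') / \<rho> t - (m t \<bullet> m t) * \<rho>' / (\<rho> t)\<^sup>2) (at t)"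
    by (subst DERIV_cong_ev[OF refl _ refl]) auto
  have th: "((\<lambda>s. \<rho> s powr gam c / (gam c - 1) * exp (S s / \<rho> s / cv c)) has_real_derivative
      (\<rho> t powr gam c / (gam c - 1) * exp (S t / \<rho> t / cv c)) *
        (gam c / \<rho> t * \<rho>' + (S' * \<rho> t - S t * \<rho>') / (\<rho> t)\<^sup>2 / cv c)) (at t)"
  proof -
    have p: "((\<lambda>s. \<rho> s powr gam c / (gam c - 1)) has_real_derivative
        (\<rho> t powr gam c / (gam c - 1)) * (gam c / \<rho> t * \<rho>')) (at t)"
      using assms(1) pos g
      by (auto intro!: derivative_eq_intros simp: powr_diff mult_ac)
    have e: "((\<lambda>s. exp (S s / \<rho> s / cv c)) has_real_derivative
        exp (S t / \<rho> t / cv c) * ((S' * \<rho> t - S t * \<rho>') / (\<rho> t)\<^sup>2 / cv c)) (at t)"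
      using assms(1,3) pos g
      by (auto intro!: derivative_eq_intros simp: power2_eq_square field_simps)
    show ?thesis
      by (rule DERIV_cong[OF DERIV_mult[OF p e]]) (simp only: distrib_left mult_ac)
  qed
  note dev_part = has_real_derivative_dev_metric_norm[OF assms(4)]
  note J_part = has_real_derivative_inner_self[OF assms(5)]
  have split: "total_energy c (\<rho> s) (m s) (S s) (A s) (J s) =
      \<rho> s powr gam c / (gam c - 1) * exp (S s / \<rho> s / cv c)
      + 1/2 * (\<rho> s * ((m s /\<^sub>R \<rho> s) \<bullet> (m s /\<^sub>R \<rho> s)))
      + 1/4 * (cs c)\<^sup>2 * (\<rho> s * (dev_metric (A s) \<bullet> dev_metric (A s)))
      + 1/2 * (ch c)\<^sup>2 * (\<rho> s * (J s \<bullet> J s))" for s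
    by (simp add: total_energy_def mult_ac)
  \<comment> \<open>The terms are collected by the rates of the five arguments, so that the
    coefficients are the partial derivatives of the energy. The exponential term stays an arbitrary
    \<open>e\<close>, which keeps the identity purely rational.\<close>
  have rearrange: "e * (gam c / \<rho> t * \<rho>' + (S' * \<rho> t - S t * \<rho>') / (\<rho> t)\<^sup>2 / cv c)
      + 1/2 * (2 * (m t \<bullet> m') / \<rho> t - (m t \<bullet> m t) * \<rho>' / (\<rho> t)\<^sup>2)
      + 1/4 * (cs c)\<^sup>2 * (\<rho>' * (dev_metric (A t) \<bullet> dev_metric (A t))
           + 4 * ((A t ** dev_metric (A t)) \<bullet> A') * \<rho> t)
      + 1/2 * (ch c)\<^sup>2 * (\<rho>' * (J t \<bullet> J t) + 2 * (J t \<bullet> J') * \<rho> t)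
    = (gam c * e / \<rho> t - e * S t / (\<rho> t)\<^sup>2 / cv c - 1/2 * ((m t /\<^sub>R \<rho> t) \<bullet> (m t /\<^sub>R \<rho> t))
       + 1/4 * (cs c)\<^sup>2 * (dev_metric (A t) \<bullet> dev_metric (A t)) + 1/2 * (ch c)\<^sup>2 * (J t \<bullet> J t)) * \<rho>'
     + (m t /\<^sub>R \<rho> t) \<bullet> m'
     + e / (\<rho> t * cv c) * S'
     + (\<rho> t * (cs c)\<^sup>2) *\<^sub>R (A t ** dev_metric (A t)) \<bullet> A'
     + (\<rho> t * (ch c)\<^sup>2) *\<^sub>R J t \<bullet> J'" for e
    using pos g(2) by (simp add: field_simps power2_eq_square)
  show ?thesis
    unfolding split Let_def
    by (rule DERIV_cong[OF _ rearrange])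
      (intro DERIV_add DERIV_cmult DERIV_mult kin th dev_part J_part assms)
qed

section \<open>Components of the augmented state\<close>

lemma inner_state:
  "x \<bullet> (y :: state) = density x * density y + momentum x \<bullet> momentum y + energy x * energy y
     + distortion x \<bullet> distortion y + impulse x \<bullet> impulse y"
  by (simp add: density_def momentum_def energy_def distortion_def impulse_def inner_prod_def)

lemma state_components_add [simp]:
  "density (x + y) = density x + density y" "momentum (x + y) = momentum x + momentum y"
  "energy (x + y) = energy x + energy y" "distortion (x + y) = distortion x + distortion y"
  "impulse (x + y) = impulse x + impulse y"
  by (simp_all add: density_def momentum_def energy_def distortion_def impulse_def)

lemma state_components_diff [simp]:
  "density (x - y) = density x - density y" "momentum (x - y) = momentum x - momentum y"
  "energy (x - y) = energy x - energy y" "distortion (x - y) = distortion x - distortion y"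
  "impulse (x - y) = impulse x - impulse y"
  by (simp_all add: density_def momentum_def energy_def distortion_def impulse_def)

lemma state_components_minus [simp]:
  "density (- x) = - density x" "momentum (- x) = - momentum x" "energy (- x) = - energy x"
  "distortion (- x) = - distortion x" "impulse (- x) = - impulse x"
  by (simp_all add: density_def momentum_def energy_def distortion_def impulse_def)

lemma state_components_scaleR [simp]:
  "density (a *\<^sub>R x) = a * density x" "momentum (a *\<^sub>R x) = a *\<^sub>R momentum x"
  "energy (a *\<^sub>R x) = a * energy x" "distortion (a *\<^sub>R x) = a *\<^sub>R distortion x"
  "impulse (a *\<^sub>R x) = a *\<^sub>R impulse x"
  by (simp_all add: density_def momentum_def energy_def distortion_def impulse_def)

lemma state_components_Pair [simp]:
  "density (\<rho>, m, e, A, J) = \<rho>" "momentum (\<rho>, m, e, A, J) = m"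
  "energy (\<rho>, m, e, A, J) = e" "distortion (\<rho>, m, e, A, J) = A"
  "impulse (\<rho>, m, e, A, J) = J"
  by (simp_all add: density_def momentum_def energy_def distortion_def impulse_def)

lemma has_vector_derivative_components:
  assumes "(u has_vector_derivative u') (at t)"
  shows "((\<lambda>s. density (u s)) has_real_derivative density u') (at t)"
    "((\<lambda>s. momentum (u s)) has_vector_derivative momentum u') (at t)"
    "((\<lambda>s. energy (u s)) has_real_derivative energy u') (at t)"
    "((\<lambda>s. distortion (u s)) has_vector_derivative distortion u') (at t)"
    "((\<lambda>s. impulse (u s)) has_vector_derivative impulse u') (at t)"
proof -
  have "bounded_linear density" "bounded_linear momentum" "bounded_linear energy"
    "bounded_linear distortion" "bounded_linear impulse"
    unfolding linear_conv_bounded_linear[symmetric] by (rule linearI; simp)+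
  from this[THEN bounded_linear.has_vector_derivative[OF _ assms]] show
    "((\<lambda>s. density (u s)) has_real_derivative density u') (at t)"
    "((\<lambda>s. momentum (u s)) has_vector_derivative momentum u') (at t)"
    "((\<lambda>s. energy (u s)) has_real_derivative energy u') (at t)"
    "((\<lambda>s. distortion (u s)) has_vector_derivative distortion u') (at t)"
    "((\<lambda>s. impulse (u s)) has_vector_derivative impulse u') (at t)"
    by (simp_all only: has_real_derivative_iff_has_vector_derivative)
qed

section \<open>Solution of the energy relation for the entropy\<close>

text \<open>
  For a state that satisfies the energy relation this is \<open>exp (S / c\<^sub>v)\<close>, obtained by comparing the
  energy with the one at entropy zero.
\<close>

definition exp_factor :: "gpr \<Rightarrow> state \<Rightarrow> real" where
  "exp_factor c u = 1 + (gam c - 1) *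
     (energy u - total_energy c (density u) (momentum u) 0 (distortion u) (impulse u))
       / density u powr gam c"

text \<open>With the other arguments fixed, the energy is an affine function of the exponential,
  with slope \<open>density u powr gam c / (gam c - 1)\<close>, which is nonzero.\<close>

lemma energy_eq_total_energy_iff:
  assumes "density u > 0" "gam c \<noteq> 1"
  shows "energy u = total_energy c (density u) (momentum u) s (distortion u) (impulse u)
    \<longleftrightarrow> exp (s / density u / cv c) = exp_factor c u"
proof -
  define a where "a = density u powr gam c"
  define e0 where "e0 = total_energy c (density u) (momentum u) 0 (distortion u) (impulse u)"
  define x where "x = exp (s / density u / cv c)"
  have "total_energy c (density u) (momentum u) s (distortion u) (impulse u) = e0 + a / (gam c - 1) * (x - 1)"
    by (simp add: total_energy_def a_def e0_def x_def algebra_simps diff_divide_distrib)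
  moreover have "energy u = e0 + a / (gam c - 1) * (x - 1) \<longleftrightarrow> x = 1 + (gam c - 1) * (energy u - e0) / a"
  proof -
    have "a \<noteq> 0" "gam c - 1 \<noteq> 0"
      using assms by (simp_all add: a_def)
    then show ?thesis
      by (simp add: divide_simps) (auto simp: algebra_simps)
  qed
  ultimately show ?thesis
    by (simp add: exp_factor_def a_def e0_def x_def)
qed

text \<open>A positive number has exactly one real logarithm, so the definite description in
  \<open>entropy\<close> has a unique witness.\<close>

lemma entropy_closed_form:
  assumes "density u > 0" "gam c \<noteq> 1" "cv c \<noteq> 0" "exp_factor c u > 0"
  shows "entropy c u = density u * cv c * ln (exp_factor c u)"
proof -
  have "exp y = exp_factor c u \<longleftrightarrow> y = ln (exp_factor c u)" for y
    using assms(4) by (metis exp_ln ln_exp)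
  then have "exp (s / density u / cv c) = exp_factor c u \<longleftrightarrow> s = density u * cv c * ln (exp_factor c u)" for s
    using assms(1,3) by (simp add: divide_eq_eq mult_ac)
  then show ?thesis
    unfolding entropy_def energy_eq_total_energy_iff[OF assms(1,2)] by simp
qed

lemma admissible_density_pos: "admissible c \<rho>0 u \<Longrightarrow> density u > 0"
  by (simp add: admissible_def)

lemma admissible_exp_factor_pos:
  assumes "admissible c \<rho>0 u" "gam c \<noteq> 1"
  shows "exp_factor c u > 0"
  using assms energy_eq_total_energy_iff[OF admissible_density_pos[OF assms(1)] assms(2)]
  by (auto simp: admissible_def) (metis exp_gt_zero)

lemma energy_entropy:
  assumes "density u > 0" "gam c \<noteq> 1" "cv c \<noteq> 0" "exp_factor c u > 0"
  shows "energy u = total_energy c (density u) (momentum u) (entropy c u) (distortion u) (impulse u)"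
  using assms by (simp add: energy_eq_total_energy_iff entropy_closed_form)

section \<open>The dual vector as the gradient of the entropy\<close>

text \<open>This is the chain rule on a curve along which the density alone moves, at unit speed;
  for \<open>temperature_eq\<close> the entropy alone moves.\<close>

lemma E_density_eq:
  assumes "density u > 0" "gam c \<noteq> 1" "cv c \<noteq> 0"
  shows "E_density c u =
    (let \<rho> = density u; e = \<rho> powr gam c / (gam c - 1) * exp (entropy c u / \<rho> / cv c) in
     gam c * e / \<rho> - e * entropy c u / \<rho>\<^sup>2 / cv c - 1/2 * (velocity u \<bullet> velocity u)
       + 1/4 * (cs c)\<^sup>2 * (dev_metric (distortion u) \<bullet> dev_metric (distortion u))
       + 1/2 * (ch c)\<^sup>2 * (impulse u \<bullet> impulse u))"
  unfolding E_density_def Let_def velocity_def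
  using has_real_derivative_total_energy[where c = c and \<rho> = "\<lambda>s. s" and \<rho>' = 1 and m = "\<lambda>_. momentum u"
      and m' = 0 and S = "\<lambda>_. entropy c u" and S' = 0 and A = "\<lambda>_. distortion u" and A' = 0
      and J = "\<lambda>_. impulse u" and J' = 0 and t = "density u"] assms
  by (intro DERIV_imp_deriv) (auto simp: Let_def mult_ac)

lemma temperature_eq:
  assumes "density u > 0" "gam c \<noteq> 1" "cv c \<noteq> 0"
  shows "temperature c u = density u powr gam c / (gam c - 1)
    * exp (entropy c u / density u / cv c) / (density u * cv c)"
  unfolding temperature_def
  using has_real_derivative_total_energy[where c = c and \<rho> = "\<lambda>_. density u" and \<rho>' = 0 and m = "\<lambda>_. momentum u"
      and m' = 0 and S = "\<lambda>s. s" and S' = 1 and A = "\<lambda>_. distortion u" and A' = 0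
      and J = "\<lambda>_. impulse u" and J' = 0 and t = "entropy c u"] assms
  by (intro DERIV_imp_deriv) (auto simp: Let_def mult_ac)

lemma temperature_nonzero:
  assumes "density u > 0" "gam c \<noteq> 1" "cv c \<noteq> 0"
  shows "temperature c u \<noteq> 0"
  using assms by (simp add: temperature_eq)

lemma inner_dual:
  "dual c u \<bullet> x = (energy x - E_density c u * density x - velocity u \<bullet> momentum x
     - alpha c u \<bullet> distortion x - beta c u \<bullet> impulse x) / temperature c u"
  by (simp add: inner_state dual_def diff_divide_distrib)

text \<open>The curve is arbitrary, so the dual vector is identified as the gradient of the entropy
  along every differentiable curve through an admissible state; the scheme enters later, as a choice
  of \<open>u'\<close>.\<close>

lemma has_real_derivative_entropy:
  assumes u: "(u has_vector_derivative u') (at t)"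
    and adm: "admissible c \<rho>0 (u t)" and g: "gam c \<noteq> 1" "cv c \<noteq> 0"
  shows "((\<lambda>s. entropy c (u s)) has_real_derivative dual c (u t) \<bullet> u') (at t)"
proof -
  note comp = has_vector_derivative_components[OF u]
  have \<rho>: "density (u t) > 0" and X: "exp_factor c (u t) > 0"
    using admissible_density_pos[OF adm] admissible_exp_factor_pos[OF adm g(1)] by auto
  \<comment> \<open>Only the existence of \<open>e'\<close>, \<open>x'\<close> and \<open>S'\<close>
    is recorded; the value of \<open>S'\<close> is found below without differentiating the closed
    form.\<close>
  obtain e' where "((\<lambda>s. total_energy c (density (u s)) (momentum (u s)) 0 (distortion (u s)) (impulse (u s)))
      has_real_derivative e') (at t)"
    using has_real_derivative_total_energy[OF comp(1,2) DERIV_const comp(4,5) \<rho> g] by blast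
  note DERIV_divide[OF DERIV_cmult[OF DERIV_diff[OF comp(3) this]] DERIV_powr[OF comp(1) \<rho> DERIV_const]]
  then obtain x' where dX: "((\<lambda>s. exp_factor c (u s)) has_real_derivative x') (at t)"
    unfolding exp_factor_def using DERIV_add[OF DERIV_const] \<rho> by fastforce
  \<comment> \<open>Admissibility is known at time \<open>t\<close> only. The two positivity
    conditions are open, hence persist nearby, and they suffice for the closed form and the energy
    relation.\<close>
  have ev: "\<forall>\<^sub>F s in nhds t. density (u s) > 0 \<and> exp_factor c (u s) > 0"
  proof (rule eventually_conj)
    show "\<forall>\<^sub>F s in nhds t. density (u s) > 0"
      using DERIV_isCont[OF comp(1)] \<rho>
      by (simp add: continuous_at_imp_continuous_within isCont_def tendsto_nhds_iff order_tendstoD(1))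
    show "\<forall>\<^sub>F s in nhds t. exp_factor c (u s) > 0"
      using DERIV_isCont[OF dX] X
      by (simp add: isCont_def tendsto_nhds_iff order_tendstoD(1))
  qed
  obtain S' where "((\<lambda>s. density (u s) * cv c * ln (exp_factor c (u s))) has_real_derivative S') (at t)"
    using DERIV_mult[OF DERIV_cmult_right[OF comp(1)] DERIV_chain2[where f = ln and g = "\<lambda>s. exp_factor c (u s)", OF DERIV_ln_divide[OF X] dX]] by blast
  moreover have "\<forall>\<^sub>F s in nhds t. entropy c (u s) = density (u s) * cv c * ln (exp_factor c (u s))"
    using ev by eventually_elim (simp add: entropy_closed_form g)
  ultimately have S: "((\<lambda>s. entropy c (u s)) has_real_derivative S') (at t)"
    by (subst DERIV_cong_ev[OF refl _ refl]) auto
  note E = has_real_derivative_total_energy[OF comp(1,2) S comp(4,5) \<rho> g]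
  have "\<forall>\<^sub>F s in nhds t. energy (u s)
      = total_energy c (density (u s)) (momentum (u s)) (entropy c (u s)) (distortion (u s)) (impulse (u s))"
    using ev by eventually_elim (simp add: energy_entropy g)
  then have "((\<lambda>s. total_energy c (density (u s)) (momentum (u s)) (entropy c (u s)) (distortion (u s))
      (impulse (u s))) has_real_derivative energy u') (at t)"
    using comp(3) by (subst (asm) DERIV_cong_ev[OF refl _ refl]) auto
  \<comment> \<open>Two expressions for the rate of the energy are equated: a linear equation for
    \<open>S'\<close>, whose coefficient is the nonzero temperature.\<close>
  from DERIV_unique[OF this E]
  have "energy u' = E_density c (u t) * density u' + velocity (u t) \<bullet> momentum u'
     + temperature c (u t) * S' + alpha c (u t) \<bullet> distortion u' + beta c (u t) \<bullet> impulse u'"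
    unfolding E_density_eq[OF \<rho> g] temperature_eq[OF \<rho> g] Let_def alpha_def beta_def velocity_def .
  then have "S' = dual c (u t) \<bullet> u'"
    using temperature_nonzero[OF \<rho> g] by (simp add: inner_dual field_simps)
  with S show ?thesis by simp
qed

section \<open>Contraction of the dual vector with the sources\<close>

lemma matrix_inv_mult_left:
  "invertible A \<Longrightarrow> matrix_inv A ** A = mat 1"
  unfolding invertible_def matrix_inv_def by (rule someI_ex[THEN conjunct2])

lemma alpha_inner_cof:
  assumes "det (distortion u) \<noteq> 0"
  shows "alpha c u \<bullet> cof u = 0"
proof -
  let ?A = "distortion u"
  have "(?A ** dev_metric ?A) \<bullet> transpose (matrix_inv ?A)
      = dev_metric ?A \<bullet> (transpose ?A ** transpose (matrix_inv ?A))"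
    by (rule inner_matrix_mult_left)
  also have "transpose ?A ** transpose (matrix_inv ?A) = mat 1"
    using matrix_inv_mult_left[of ?A] assms
    by (simp add: matrix_transpose_mul[symmetric] invertible_det_nz)
  also have "dev_metric ?A \<bullet> mat 1 = 0"
    by (simp add: inner_mat_1 trace_dev_metric)
  finally show ?thesis
    by (simp add: alpha_def cof_def)
qed

text \<open>The term with \<open>\<pi>\<close> points along \<open>cof u\<close> and is orthogonal
  to \<alpha>. The relaxation terms carry a minus sign, as do \<alpha> and \<beta> in the dual
  vector, which leaves the two squares with a plus sign.\<close>

lemma dual_inner_source:
  assumes "det (distortion u) \<noteq> 0"
  shows "dual c u \<bullet> source c \<rho>0 \<pi> u =
    alpha c u \<bullet> alpha c u / (theta1 c \<rho>0 u * temperature c u)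
    + beta c u \<bullet> beta c u / (theta2 c \<rho>0 u * temperature c u)"
  by (simp add: inner_dual source_def inner_add_right inner_diff_right alpha_inner_cof[OF assms] divide_simps)

section \<open>Behaviour of the fluxes when the two cells are exchanged\<close>

lemma avg_velocity_commute: "avg_velocity uL uR = avg_velocity uR uL"
  by (simp add: avg_velocity_def add.commute)

text \<open>The normal and the jump both change sign while the averaged velocity is symmetric, so
  the product is even under the exchange.\<close>

lemma ncp_A_swap: "ncp_A uR uL (- n) = ncp_A uL uR n"
  unfolding ncp_A_def avg_velocity_commute[of uR uL]
  by (simp add: vec_eq_iff algebra_simps)

lemma ncp_swap: "ncp uR uL (- n) = ncp uL uR n"
  unfolding ncp_def ncp_A_swap ncp_J_def avg_velocity_commute[of uR uL]
  by (simp add: vec_eq_iff algebra_simps)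

lemma linear_flux: "linear (flux c u)"
  by (rule linearI)
    (simp_all add: flux_def flux_A_def inner_add_right matrix_vector_right_distrib
      matrix_vector_mult_scaleR vec_eq_iff algebra_simps)

lemma flux_minus: "flux c u (- n) = - flux c u n"
  by (rule linear_neg[OF linear_flux])

lemma flux_A_minus: "flux_A u (- n) = - flux_A u n"
  by (simp add: flux_A_def vec_eq_iff)

lemma linear_entropy_flux: "linear (entropy_flux c u)"
  by (rule linearI) (simp_all add: entropy_flux_def inner_add_right)

lemma entropy_flux_minus: "entropy_flux c u (- n) = - entropy_flux c u n"
  by (rule linear_neg[OF linear_entropy_flux])

lemma eps_commute: "eps c uL uR = eps c uR uL"
  by (simp add: eps_def max.commute)

lemma geo_flux_A_with_swap: "geo_flux_A_with a uR uL (- n) = - geo_flux_A_with a uL uR n"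
  by (simp add: geo_flux_A_with_def flux_A_minus algebra_simps)

text \<open>Exchanging the cells turns the defining equation into itself with its summands
  reordered, so both descriptions name the same number and the equation need not be solved.\<close>

lemma alpha_A_swap: "alpha_A uR uL (- n) = alpha_A uL uR n"
  unfolding alpha_A_def geo_flux_A_with_swap
  by (simp add: flux_A_minus ncp_A_swap inner_diff_right inner_diff_left algebra_simps eq_commute[of "cof uR"]
     cong: if_cong)

lemma geo_flux_A_swap: "geo_flux_A uR uL (- n) = - geo_flux_A uL uR n"
  by (simp add: geo_flux_A_def alpha_A_swap geo_flux_A_with_swap)

lemma det_flux_swap:
  "det_flux_L c uR uL (- n) = - det_flux_R c uL uR n"
  "det_flux_R c uR uL (- n) = - det_flux_L c uL uR n"
  by (simp_all add: det_flux_L_def det_flux_R_def geo_flux_A_swap flux_A_minus eps_commute[of c uR uL]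
      ncp_A_swap[of uL uR, simplified] inner_add_right inner_diff_right)

lemma geo_flux_swap: "geo_flux c \<rho>0 uR uL (- n) = - geo_flux c \<rho>0 uL uR n"
  by (simp add: geo_flux_def Let_def det_flux_swap geo_flux_A_swap flux_minus algebra_simps)

text \<open>In every term of the numerator the sign changes cancel in pairs, and the denominator is
  a squared norm of a jump.\<close>

lemma alpha_S_swap: "alpha_S c \<rho>0 uR uL (- n) = alpha_S c \<rho>0 uL uR n"
proof -
  have "(dual_red c uL - dual_red c uR) \<bullet> (dual_red c uL - dual_red c uR)
      = (dual_red c uR - dual_red c uL) \<bullet> (dual_red c uR - dual_red c uL)"
    by (simp add: inner_diff_left inner_diff_right inner_commute)
  then show ?thesis
    by (simp add: alpha_S_def geo_flux_swap flux_minus entropy_flux_minus ncp_swap eq_commute[of "dual_red c uR"]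
       inner_diff_right add.commute)
qed

lemma thermo_flux_swap: "thermo_flux c \<rho>0 uR uL (- n) = - thermo_flux c \<rho>0 uL uR n"
  by (simp add: thermo_flux_def geo_flux_swap alpha_S_swap algebra_simps)

text \<open>This is the conservation property of the entropy flux. Both sides carry the same
  \<open>\<rho>0\<close>, which scales the density flux.\<close>

lemma num_entropy_flux_swap:
  "num_entropy_flux c \<rho>0 uR uL (- n) = - num_entropy_flux c \<rho>0 uL uR n"
proof -
  have "entropy_flux_L c \<rho>0 uR uL (- n) = - entropy_flux_R c \<rho>0 uL uR n"
    "entropy_flux_R c \<rho>0 uR uL (- n) = - entropy_flux_L c \<rho>0 uL uR n"
    using ncp_swap[of uL uR n] ncp_swap[of uR uL n]
    by (simp_all add: entropy_flux_L_def entropy_flux_R_def thermo_flux_swap flux_minus entropy_flux_minus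
        eps_commute[of c uR uL] inner_add_right inner_diff_right)
  then show ?thesis
    by (simp add: num_entropy_flux_def field_simps)
qed

section \<open>Compatibility and dissipation on a single edge\<close>

text \<open>The dual and the reduced dual vectors agree in the entries in which the latter do not vanish.\<close>

lemma dual_red_inner_dual_diff:
  "(dual_red c uR - dual_red c uL) \<bullet> (dual c uR - dual c uL)
     = (dual_red c uR - dual_red c uL) \<bullet> (dual_red c uR - dual_red c uL)"
  by (simp add: inner_state dual_red_def dual_def)

text \<open>The requirement is affine in \<open>alpha_S\<close>. Its coefficient is the contraction
  of the reduced with the full dual jump, which equals the denominator of \<open>alpha_S\<close> and
  is nonzero here.\<close>

lemma thermo_compatible_nondegenerate:
  assumes "dual_red c uL \<noteq> dual_red c uR"
  shows "thermo_compatible c \<rho>0 uL uR n"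
proof -
  let ?dr = "dual_red c uR - dual_red c uL" and ?d = "dual c uR - dual c uL"
  have "?dr \<bullet> ?dr \<noteq> 0"
    using assms by simp
  then have "alpha_S c \<rho>0 uL uR n * (?dr \<bullet> ?dr) = entropy_flux c uR n - entropy_flux c uL n
      + geo_flux c \<rho>0 uL uR n \<bullet> ?d - (dual c uR \<bullet> flux c uR n - dual c uL \<bullet> flux c uL n)
      - (dual c uR + dual c uL) \<bullet> ncp uL uR n"
    using assms unfolding alpha_S_def by simp
  moreover have "thermo_flux c \<rho>0 uL uR n \<bullet> ?d
      = geo_flux c \<rho>0 uL uR n \<bullet> ?d - alpha_S c \<rho>0 uL uR n * (?dr \<bullet> ?dr)"
    by (simp only: thermo_flux_def inner_diff_left[of "geo_flux c \<rho>0 uL uR n"] inner_scaleR_left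
        dual_red_inner_dual_diff)
  ultimately show ?thesis
    unfolding thermo_compatible_def ncp_swap
    by (simp add: inner_diff_right inner_add_left inner_commute[of "thermo_flux c \<rho>0 uL uR n"]
        algebra_simps)
qed

text \<open>The viscous part of \<open>entropy_flux_L\<close>, twice \<open>eps\<close> times the
  left entropy, combines with minus \<open>eps\<close> times the entropy sum into minus
  \<open>eps\<close> times the entropy jump.\<close>

lemma num_entropy_flux_eq:
  assumes "thermo_compatible c \<rho>0 uL uR n"
  shows "num_entropy_flux c \<rho>0 uL uR n = entropy_flux c uL n - dual c uL \<bullet> flux c uL n
    + dual c uL \<bullet> (thermo_flux c \<rho>0 uL uR n + ncp uL uR n) - eps c uL uR * (entropy c uR - entropy c uL)"
  using assms
  unfolding thermo_compatible_def num_entropy_flux_def entropy_flux_L_def entropy_flux_R_def ncp_swap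
  by (simp add: inner_diff_right inner_add_right algebra_simps)

text \<open>The left dual vector is the mean of the two dual vectors minus half their jump. The mean
  gives the trapezoidal sum, that is, the entropy jump plus \<open>jump_error\<close>; the half jump
  is \<open>H (uR - uL)\<close> halved and gives the quadratic form.\<close>

lemma dual_inner_dissipation:
  assumes "roe_hessian c uL uR H"
  shows "dual c uL \<bullet> dissipation c uL uR = eps c uL uR * (1/2 * ((uR - uL) \<bullet> H (uR - uL)))
    - eps c uL uR * (entropy c uR - entropy c uL) - eps c uL uR * jump_error c uL uR"
proof -
  define d where "d = uR - uL"
  have "dual c uR = dual c uL + H d"
    using assms by (simp add: roe_hessian_def d_def)
  then show ?thesis
    by (simp add: dissipation_def jump_error_def d_def[symmetric] inner_add_left inner_commute algebra_simps)
qed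

section \<open>Summation over the cell boundary and the entropy balance\<close>

lemma (in fv_mesh) sum_linear_closed_cell:
  assumes "linear (f :: real^3 \<Rightarrow> real)"
  shows "(\<Sum>r\<in>nbrs l. len l r / area l * f (nrm l r)) = 0"
proof -
  have "(\<Sum>r\<in>nbrs l. len l r / area l * f (nrm l r))
      = f (\<Sum>r\<in>nbrs l. len l r *\<^sub>R nrm l r) / area l"
    by (simp add: linear_sum[OF assms] linear_scale[OF assms] sum_divide_distrib)
  then show ?thesis
    by (simp add: closed_cell linear_0[OF assms])
qed

lemma eps_nonneg: "eps c uL uR \<ge> 0"
  by (simp add: eps_def)

theorem theorem2:
  fixes c :: gpr
    and nbrs :: "'c \<Rightarrow> 'c set"
    and area rho0 :: "'c \<Rightarrow> real"
    and len :: "'c \<Rightarrow> 'c \<Rightarrow> real"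
    and nrm :: "'c \<Rightarrow> 'c \<Rightarrow> real^3"
    and u :: "'c \<Rightarrow> real \<Rightarrow> state"
    and H :: "'c \<Rightarrow> 'c \<Rightarrow> state \<Rightarrow> state"
    and l :: 'c and t :: real
  assumes mesh: "fv_mesh nbrs area len nrm"
    and constants: "gam c \<noteq> 1" "cv c \<noteq> 0" "tau1 c > 0" "tau2 c > 0"
    and states: "\<And>k. k \<in> insert l (nbrs l) \<Longrightarrow> admissible c (rho0 k) (u k t)"
    and theta: "theta1 c (rho0 l) (u l t) > 0" "theta2 c (rho0 l) (u l t) > 0"
    and scheme: "scheme_at c nbrs area len nrm rho0 u l t"
    and degenerate: "\<And>r. r \<in> nbrs l \<Longrightarrow> dual_red c (u l t) = dual_red c (u r t) \<Longrightarrow>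
          thermo_compatible c (rho0 l) (u l t) (u r t) (nrm l r)"
    and roe: "\<And>r. r \<in> nbrs l \<Longrightarrow> roe_hessian c (u l t) (u r t) (H l r)"
  shows "let dS = deriv (\<lambda>s. entropy c (u l s)) t;
             div_F = (\<Sum>r\<in>nbrs l. len l r / area l *
                       num_entropy_flux c (rho0 l) (u l t) (u r t) (nrm l r));
             P = entropy_production c nbrs area len rho0 H (\<lambda>k. u k t) l;
             exact_jumps = (\<forall>r\<in>nbrs l. jump_error c (u l t) (u r t) = 0)
         in (\<lambda>s. entropy c (u l s)) differentiable (at t) \<and>
            (exact_jumps \<longrightarrow> dS + div_F = P) \<and>
            dS + div_F = P + (\<Sum>r\<in>nbrs l. len l r / area l *
                               (eps c (u l t) (u r t) * jump_error c (u l t) (u r t))) \<and>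
            (\<forall>r\<in>nbrs l. rho0 r = rho0 l \<longrightarrow>
               num_entropy_flux c (rho0 r) (u r t) (u l t) (nrm r l)
                 = - num_entropy_flux c (rho0 l) (u l t) (u r t) (nrm l r)) \<and>
            (temperature c (u l t) > 0 \<and> (\<forall>r\<in>nbrs l. neg_semidef (H l r)) \<longrightarrow>
               P \<ge> 0 \<and> (exact_jumps \<longrightarrow> dS + div_F \<ge> 0))"
proof -
  interpret fv_mesh nbrs area len nrm by (rule mesh)
  let ?w = "\<lambda>r. len l r / area l" and ?L = "u l t" and ?R = "\<lambda>r. u r t"
  define dS where "dS = deriv (\<lambda>s. entropy c (u l s)) t"
  define div_F where "div_F = (\<Sum>r\<in>nbrs l. ?w r * num_entropy_flux c (rho0 l) ?L (?R r) (nrm l r))"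
  define P where "P = entropy_production c nbrs area len rho0 H (\<lambda>k. u k t) l"
  let ?thermo = "\<lambda>r. thermo_flux c (rho0 l) ?L (?R r) (nrm l r)"
  let ?ncp = "\<lambda>r. ncp ?L (?R r) (nrm l r)" and ?diss = "\<lambda>r. dissipation c ?L (?R r)"
  let ?src = "source c (rho0 l) (Pi_A c nbrs area len (\<lambda>k. u k t) l) ?L"
  obtain u' where u': "(u l has_vector_derivative u') (at t)"
    and eq: "u' + (\<Sum>r\<in>nbrs l. ?w r *\<^sub>R (?thermo r + ?ncp r + ?diss r)) = ?src"
    using scheme unfolding scheme_at_def by blast
  have adm: "admissible c (rho0 l) ?L"
    using states by simp
  have det: "det (distortion ?L) \<noteq> 0"
    using adm by (simp add: admissible_def)
  have deriv: "((\<lambda>s. entropy c (u l s)) has_real_derivative dual c ?L \<bullet> u') (at t)"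
    by (rule has_real_derivative_entropy[OF u' adm constants(1,2)])
  then have dS: "dS = dual c ?L \<bullet> u'"
    unfolding dS_def by (rule DERIV_imp_deriv)
  have w_nonneg: "?w r \<ge> 0" if "r \<in> nbrs l" for r
    using len_pos[OF that] area_pos[of l] by simp

  let ?e = "\<lambda>r. eps c ?L (?R r)" and ?j = "\<lambda>r. jump_error c ?L (?R r)"
  let ?q = "\<lambda>r. 1/2 * ((?R r - ?L) \<bullet> H l r (?R r - ?L))"
  \<comment> \<open>The part of the flux that sees the neighbour through the normal only.\<close>
  let ?g = "\<lambda>n. entropy_flux c ?L n - dual c ?L \<bullet> flux c ?L n"
  have "linear ?g"
    by (intro linear_compose_sub linear_entropy_flux linear_compose[OF linear_flux, unfolded o_def]
        bounded_linear.linear[OF bounded_linear_inner_right])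
  then have closed: "(\<Sum>r\<in>nbrs l. ?w r * ?g (nrm l r)) = 0"
    by (rule sum_linear_closed_cell)
  \<comment> \<open>The dissipation is placed inside the contraction so that the sum over the edges
    reproduces the scheme; the last two terms compensate for it by the Roe identity.\<close>
  have edge: "num_entropy_flux c (rho0 l) ?L (?R r) (nrm l r)
      = ?g (nrm l r) + dual c ?L \<bullet> (?thermo r + ?ncp r + ?diss r) - ?e r * ?q r + ?e r * ?j r"
    if r: "r \<in> nbrs l" for r
  proof -
    \<comment> \<open>Compatibility comes from the formula for \<open>alpha_S\<close> where the
      reduced dual vectors differ, and from the hypothesis \<open>degenerate\<close> where they
      coincide.\<close>
    have "thermo_compatible c (rho0 l) ?L (?R r) (nrm l r)"
      using degenerate[OF r] thermo_compatible_nondegenerate by blast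
    from num_entropy_flux_eq[OF this] dual_inner_dissipation[OF roe[OF r]] show ?thesis
      by (simp add: inner_add_right)
  qed
  have "div_F = (\<Sum>r\<in>nbrs l. ?w r * ?g (nrm l r))
      + (\<Sum>r\<in>nbrs l. ?w r * (dual c ?L \<bullet> (?thermo r + ?ncp r + ?diss r)))
      - (\<Sum>r\<in>nbrs l. ?w r * (?e r * ?q r)) + (\<Sum>r\<in>nbrs l. ?w r * (?e r * ?j r))"
    unfolding div_F_def sum.distrib[symmetric] sum_subtractf[symmetric]
    by (rule sum.cong[OF refl]) (simp only: edge distrib_left right_diff_distrib)
  also have "(\<Sum>r\<in>nbrs l. ?w r * (dual c ?L \<bullet> (?thermo r + ?ncp r + ?diss r))) = dual c ?L \<bullet> (?src - u')"
    by (simp add: eq[symmetric] inner_sum_right)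
  also have "\<dots> = dual c ?L \<bullet> ?src - dS"
    by (simp add: dS inner_diff_right)
  finally have "dS + div_F = dual c ?L \<bullet> ?src - (\<Sum>r\<in>nbrs l. ?w r * (?e r * ?q r))
      + (\<Sum>r\<in>nbrs l. ?w r * (?e r * ?j r))"
    using closed by simp
  \<comment> \<open>The contracted source supplies the two relaxation terms of \<open>P\<close>, and
    the sum of the quadratic forms with its minus sign is \<open>Pi_visc\<close>.\<close>
  then have balance: "dS + div_F = P + (\<Sum>r\<in>nbrs l. ?w r * (?e r * ?j r))"
    unfolding dual_inner_source[OF det] P_def entropy_production_def Pi_visc_def
    by (simp add: mult_ac)
  then have exact: "dS + div_F = P" if "\<forall>r\<in>nbrs l. ?j r = 0"
    using that by simp
  have P_nonneg: "P \<ge> 0" if T: "temperature c ?L > 0" and H: "\<forall>r\<in>nbrs l. neg_semidef (H l r)"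
  proof -
    have "(\<Sum>r\<in>nbrs l. ?w r * (1/2 * ?e r * ((?R r - ?L) \<bullet> H l r (?R r - ?L)))) \<le> 0"
      using H by (intro sum_nonpos mult_nonneg_nonpos w_nonneg mult_nonneg_nonneg eps_nonneg)
        (auto simp: neg_semidef_def simp del: split_paired_All)
    then have "Pi_visc c nbrs area len H (\<lambda>k. u k t) l \<ge> 0"
      by (simp add: Pi_visc_def mult_ac)
    then show ?thesis
      unfolding P_def entropy_production_def using T theta
      by (intro add_nonneg_nonneg divide_nonneg_pos mult_pos_pos) auto
  qed
  have swap: "num_entropy_flux c (rho0 r) (?R r) ?L (nrm r l) = - num_entropy_flux c (rho0 l) ?L (?R r) (nrm l r)"
    if "r \<in> nbrs l" "rho0 r = rho0 l" for r
    using that by (simp add: nrm_antisym num_entropy_flux_swap)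
  show ?thesis
    unfolding Let_def dS_def[symmetric] div_F_def[symmetric] P_def[symmetric]
    using deriv exact balance swap P_nonneg by (auto simp: real_differentiable_def)
qed

end
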